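(* Let $u_{nom}:\mathbb{R}^n\to\mathbb{R}^m$ be locally Lipschitz continuous and satisfy the CLF condition, i.e. $L_fV(x)+L_gV(x)u_{nom}(x)\le-\gamma(V(x))$ for all $x\in\mathbb{R}^n$. Put $f'(x)=f(x)+g(x)u_{nom}(x)$, fix $p>0$, and let $u'(x)$ be the $u'$-component of the pointwise solution of the quadratic program $$\min_{(u',\delta)\in\mathbb{R}^{m+1}}\tfrac12\|u'\|^2+\tfrac12p\,\delta^2\quad\text{s.t.}\quad L_{f'}V(x)+L_gV(x)u'+\gamma(V(x))\le\delta,\qquad L_{f'}h(x)+L_gh(x)u'+\alpha(h(x))\ge0 .$$ Assume that one of the following two conditions holds: (i) $L_gh(x)\ne0$ for all $x\in\mathbb{R}^n$; or (ii) the set $\{x\in\mathbb{R}^n: L_{f'}h(x)+\alpha(h(x))=0,\ L_gh(x)=0\}$ is empty. Let the control input $u(x)=u_{nom}(x)+u'(x)$ be applied to $\dot x=f(x)+g(x)u$. Then for the closed-loop system: 1. the set $\mathscr{C}$ is forward invariant; 2. no equilibrium points in $\mathrm{Int}(\mathscr{C})$ exist except the origin; 3. no equilibrium points $x\in\partial\mathscr{C}$ with $L_gh(x)=0$ exist; 4. the origin is locally asymptotically stable.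
   Context: Setting: $\dot x=f(x)+g(x)u$, $x\in\mathbb{R}^n$, $u\in\mathbb{R}^m$, with $f:\mathbb{R}^n\to\mathbb{R}^n$ and $g:\mathbb{R}^n\to\mathbb{R}^{n\times m}$ locally Lipschitz. For a differentiable $\phi:\mathbb{R}^n\to\mathbb{R}$, $L_f\phi=\nabla\phi^\top f\in\mathbb{R}$ and $L_g\phi=\nabla\phi^\top g\in\mathbb{R}^{1\times m}$ (and $L_{f'}\phi=\nabla\phi^\top f'$). $V:\mathbb{R}^n\to\mathbb{R}$ is a control Lyapunov function (CLF): $V$ is smooth and positive definite ($V(0)=0$, $V(x)>0$ for $x\ne0$), and $\inf_{u\in\mathbb{R}^m}[L_fV(x)+L_gV(x)u]\le-\gamma(V(x))$ for all $x\in\mathbb{R}^n$, where $\gamma:\mathbb{R}_{\ge0}\to\mathbb{R}_{\ge0}$ is class $\mathcal{K}$ (continuous, strictly increasing, $\gamma(0)=0$). $h:\mathbb{R}^n\to\mathbb{R}$ is a control barrier function (CBF): $h$ is smooth and $\sup_{u\in\mathbb{R}^m}[L_fh(x)+L_gh(x)u+\alpha(h(x))]\ge0$ for all $x\in\mathbb{R}^n$, where $\alpha:\mathbb{R}\to\mathbb{R}$ is a locally Lipschitz extended class $\mathcal{K}$ function (continuous, strictly increasing, $\alpha(0)=0$). The safety set is $\mathscr{C}=\{x: h(x)\ge0\}$, with $\mathrm{Int}(\mathscr{C})=\{x:h(x)>0\}$ and $\partial\mathscr{C}=\{x:h(x)=0\}$. The origin is in $\mathrm{Int}(\mathscr{C})$.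 These functions $\gamma,\alpha$ are the ones used in the quadratic program. A set $\mathscr{A}$ is forward invariant if every solution of the closed-loop system starting at time $t_0$ from a point of $\mathscr{A}$ remains in $\mathscr{A}$ for all later times in its interval of existence. An equilibrium point of the closed-loop system is a point where $f(x)+g(x)u(x)=0$. *)

theory Defs
  imports "HOL-Analysis.Analysis"
begin

text \<open>The time argument of the library notion is a dummy here, since all maps are autonomous.\<close>

abbreviation locally_lipschitz :: "('a::metric_space \<Rightarrow> 'b::metric_space) \<Rightarrow> bool"
  where "locally_lipschitz F \<equiv> local_lipschitz (UNIV :: real set) UNIV (\<lambda>_. F)"

text \<open>\<open>C_k k \<phi>\<close>: all iterated directional derivatives of \<open>\<phi>\<close> up to order \<open>k\<close> exist as
  Frechet derivatives and are continuous.\<close>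

primrec C_k :: "nat \<Rightarrow> ('a::euclidean_space \<Rightarrow> real) \<Rightarrow> bool"
  where
    "C_k 0 \<phi> \<longleftrightarrow> continuous_on UNIV \<phi>"
  | "C_k (Suc k) \<phi> \<longleftrightarrow>
      (\<forall>x. \<phi> differentiable at x) \<and> (\<forall>v. C_k k (\<lambda>x. frechet_derivative \<phi> (at x) v))"

definition smooth :: "('a::euclidean_space \<Rightarrow> real) \<Rightarrow> bool"
  where "smooth \<phi> \<longleftrightarrow> (\<forall>k. C_k k \<phi>)"

definition gradient :: "('a::euclidean_space \<Rightarrow> real) \<Rightarrow> 'a \<Rightarrow> 'a"
  where "gradient \<phi> x = (THE D. GDERIV \<phi> x :> D)"

definition lie_f :: "(real^'n \<Rightarrow> real^'n) \<Rightarrow> (real^'n \<Rightarrow> real) \<Rightarrow> real^'n \<Rightarrow> real"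
  where "lie_f f \<phi> x = gradient \<phi> x \<bullet> f x"

text \<open>An \<open>n \<times> m\<close> matrix has type \<^typ>\<open>real^'m^'n\<close>. The row vector obtained below is used as an
  element of \<^typ>\<open>real^'m\<close>, so that its product with an input \<open>u\<close> is an inner product.\<close>

definition lie_g :: "(real^'n \<Rightarrow> real^'m^'n) \<Rightarrow> (real^'n \<Rightarrow> real) \<Rightarrow> real^'n \<Rightarrow> real^'m"
  where "lie_g g \<phi> x = gradient \<phi> x v* g x"

definition class_K :: "(real \<Rightarrow> real) \<Rightarrow> bool"
  where "class_K \<gamma> \<longleftrightarrow> continuous_on {0..} \<gamma> \<and> strict_mono_on {0..} \<gamma> \<and> \<gamma> 0 = 0"

definition extended_class_K :: "(real \<Rightarrow> real) \<Rightarrow> bool"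
  where "extended_class_K \<alpha> \<longleftrightarrow> continuous_on UNIV \<alpha> \<and> strict_mono \<alpha> \<and> \<alpha> 0 = 0"

text \<open>The infimum and the supremum over all inputs are taken in the extended reals, because they
  are infinite wherever \<open>L\<^sub>g V\<close>, respectively \<open>L\<^sub>g h\<close>, is nonzero.\<close>

definition control_lyapunov_function ::
    "(real^'n \<Rightarrow> real^'n) \<Rightarrow> (real^'n \<Rightarrow> real^'m^'n) \<Rightarrow> (real \<Rightarrow> real) \<Rightarrow> (real^'n \<Rightarrow> real) \<Rightarrow> bool"
  where "control_lyapunov_function f g \<gamma> V \<longleftrightarrow>
    smooth V \<and> V 0 = 0 \<and> (\<forall>x. x \<noteq> 0 \<longrightarrow> V x > 0) \<and> class_K \<gamma> \<and>
    (\<forall>x. (INF u. ereal (lie_f f V x + lie_g g V x \<bullet> u)) \<le> ereal (- \<gamma> (V x)))"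

definition control_barrier_function ::
    "(real^'n \<Rightarrow> real^'n) \<Rightarrow> (real^'n \<Rightarrow> real^'m^'n) \<Rightarrow> (real \<Rightarrow> real) \<Rightarrow> (real^'n \<Rightarrow> real) \<Rightarrow> bool"
  where "control_barrier_function f g \<alpha> h \<longleftrightarrow>
    smooth h \<and> extended_class_K \<alpha> \<and> locally_lipschitz \<alpha> \<and>
    (\<forall>x. (SUP u. ereal (lie_f f h x + lie_g g h x \<bullet> u + \<alpha> (h x))) \<ge> 0)"

definition safe_set :: "('a \<Rightarrow> real) \<Rightarrow> 'a set"
  where "safe_set h = {x. h x \<ge> 0}"

text \<open>The interior and the boundary of the safe set are by convention the following sets, which
  need not be the topological ones for an arbitrary \<open>h\<close>.\<close>

definition safe_interior :: "('a \<Rightarrow> real) \<Rightarrow> 'a set"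
  where "safe_interior h = {x. h x > 0}"

definition safe_boundary :: "('a \<Rightarrow> real) \<Rightarrow> 'a set"
  where "safe_boundary h = {x. h x = 0}"

definition qp_cost :: "real \<Rightarrow> (real^'m) \<times> real \<Rightarrow> real"
  where "qp_cost p = (\<lambda>(v, \<delta>). 1/2 * (norm v)\<^sup>2 + 1/2 * p * \<delta>\<^sup>2)"

definition qp_feasible ::
    "(real^'n \<Rightarrow> real^'n) \<Rightarrow> (real^'n \<Rightarrow> real^'m^'n) \<Rightarrow> (real^'n \<Rightarrow> real) \<Rightarrow> (real^'n \<Rightarrow> real) \<Rightarrow>
     (real \<Rightarrow> real) \<Rightarrow> (real \<Rightarrow> real) \<Rightarrow> real^'n \<Rightarrow> ((real^'m) \<times> real) set"
  where "qp_feasible f g V h \<gamma> \<alpha> x = {(v, \<delta>).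
    lie_f f V x + lie_g g V x \<bullet> v + \<gamma> (V x) \<le> \<delta> \<and>
    lie_f f h x + lie_g g h x \<bullet> v + \<alpha> (h x) \<ge> 0}"

definition qp_solution ::
    "(real^'n \<Rightarrow> real^'n) \<Rightarrow> (real^'n \<Rightarrow> real^'m^'n) \<Rightarrow> (real^'n \<Rightarrow> real) \<Rightarrow> (real^'n \<Rightarrow> real) \<Rightarrow>
     (real \<Rightarrow> real) \<Rightarrow> (real \<Rightarrow> real) \<Rightarrow> real \<Rightarrow> real^'n \<Rightarrow> (real^'m) \<times> real"
  where "qp_solution f g V h \<gamma> \<alpha> p x = arg_min_on (qp_cost p) (qp_feasible f g V h \<gamma> \<alpha> x)"

definition closed_loop ::
    "(real^'n \<Rightarrow> real^'n) \<Rightarrow> (real^'n \<Rightarrow> real^'m^'n) \<Rightarrow> (real^'n \<Rightarrow> real^'m) \<Rightarrow> real^'n \<Rightarrow> real^'n"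
  where "closed_loop f g u x = f x + g x *v u x"

definition solution_on :: "('a::real_normed_vector \<Rightarrow> 'a) \<Rightarrow> real set \<Rightarrow> (real \<Rightarrow> 'a) \<Rightarrow> bool"
  where "solution_on F I x \<longleftrightarrow>
    is_interval I \<and> (\<forall>t\<in>I. (x has_vector_derivative F (x t)) (at t within I))"

definition equilibrium_point :: "('a::real_normed_vector \<Rightarrow> 'a) \<Rightarrow> 'a \<Rightarrow> bool"
  where "equilibrium_point F x \<longleftrightarrow> F x = 0"

definition forward_invariant :: "('a::real_normed_vector \<Rightarrow> 'a) \<Rightarrow> 'a set \<Rightarrow> bool"
  where "forward_invariant F A \<longleftrightarrow>
    (\<forall>I x t\<^sub>0. solution_on F I x \<and> t\<^sub>0 \<in> I \<and> x t\<^sub>0 \<in> A \<longrightarrow> (\<forall>t\<in>I. t \<ge> t\<^sub>0 \<longrightarrow> x t \<in> A))"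

definition lyapunov_stable :: "('a::real_normed_vector \<Rightarrow> 'a) \<Rightarrow> 'a \<Rightarrow> bool"
  where "lyapunov_stable F e \<longleftrightarrow>
    (\<forall>\<epsilon>>0. \<exists>\<eta>>0. \<forall>I x t\<^sub>0. solution_on F I x \<and> t\<^sub>0 \<in> I \<and> dist (x t\<^sub>0) e < \<eta> \<longrightarrow>
      (\<forall>t\<in>I. t \<ge> t\<^sub>0 \<longrightarrow> dist (x t) e < \<epsilon>))"

text \<open>Attractivity includes that nearby initial states have solutions for all future times;
  otherwise convergence could hold vacuously.\<close>

definition locally_attractive :: "('a::real_normed_vector \<Rightarrow> 'a) \<Rightarrow> 'a \<Rightarrow> bool"
  where "locally_attractive F e \<longleftrightarrow>
    (\<exists>\<eta>>0. \<forall>t\<^sub>0 x\<^sub>0. dist x\<^sub>0 e < \<eta> \<longrightarrow>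
      (\<exists>x. solution_on F {t\<^sub>0..} x \<and> x t\<^sub>0 = x\<^sub>0) \<and>
      (\<forall>x. solution_on F {t\<^sub>0..} x \<and> x t\<^sub>0 = x\<^sub>0 \<longrightarrow> (x \<longlongrightarrow> e) at_top))"

definition locally_asymptotically_stable :: "('a::real_normed_vector \<Rightarrow> 'a) \<Rightarrow> 'a \<Rightarrow> bool"
  where "locally_asymptotically_stable F e \<longleftrightarrow>
    equilibrium_point F e \<and> lyapunov_stable F e \<and> locally_attractive F e"

end

theory Submission
  imports Defs
begin

text \<open>The barrier constraint gives \<open>dh/dt \<ge> - \<alpha> h\<close>, so \<open>h\<close> cannot decrease while negative. At an
  equilibrium in the interior this constraint is inactive, and without it the minimiser is \<open>(0, 0)\<close>
  because \<open>u\<^sub>n\<^sub>o\<^sub>m\<close> already satisfies the CLF condition; so \<open>L\<^sub>f\<^sub>' V = 0\<close>, which forces the point to be the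
  origin. At a boundary equilibrium with \<open>L\<^sub>g h = 0\<close>, \<open>L\<^sub>f\<^sub>' h + \<alpha> h\<close> would vanish, which (i) and (ii) exclude.
  Near the origin \<open>(0, 0)\<close> is feasible, so there the closed loop is the Lipschitz field \<open>f'\<close>, for which
  \<open>V\<close> is a strict Lyapunov function.\<close>

section \<open>Gradients of smooth functions\<close>

text \<open>The definite description in \<open>gradient\<close> has to be justified: a representing
  vector exists as the adjoint of the derivative applied to 1, and the inner product separates
  vectors.\<close>

lemma has_derivative_gradient:
  fixes \<phi> :: "'a::euclidean_space \<Rightarrow> real"
  assumes "\<phi> differentiable at x"
  shows "(\<phi> has_derivative (\<lambda>v. gradient \<phi> x \<bullet> v)) (at x)"
proof -
  let ?D = "frechet_derivative \<phi> (at x)"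
  have D: "(\<phi> has_derivative ?D) (at x)"
    using assms frechet_derivative_works by blast
  then have lin: "linear ?D"
    by (rule has_derivative_linear)
  have "GDERIV \<phi> x :> adjoint ?D 1"
    unfolding gderiv_def using D adjoint_works[OF lin, of _ 1] by (simp add: fun_eq_iff inner_commute)
  moreover have "d = e" if "GDERIV \<phi> x :> d" "GDERIV \<phi> x :> e" for d e
    using has_derivative_unique[OF that[unfolded gderiv_def]] by (metis vector_eq_ldot)
  ultimately have "GDERIV \<phi> x :> gradient \<phi> x"
    unfolding gradient_def by (metis theI)
  then show ?thesis
    by (simp add: gderiv_def inner_commute)
qed

lemma smooth_differentiable: "smooth \<phi> \<Longrightarrow> \<phi> differentiable at x"
  unfolding smooth_def by (metis C_k.simps(2))

text \<open>\<open>C_k 1\<close> makes each directional derivative continuous; the gradient is the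
  finite sum of those along the basis.\<close>

lemma smooth_continuous_gradient:
  fixes \<phi> :: "'a::euclidean_space \<Rightarrow> real"
  assumes "smooth \<phi>"
  shows "continuous_on UNIV (gradient \<phi>)"
proof -
  have "C_k (Suc 0) \<phi>"
    using assms by (simp add: smooth_def del: C_k.simps)
  then have cont: "continuous_on UNIV (\<lambda>x. frechet_derivative \<phi> (at x) b)" for b
    by simp
  have "frechet_derivative \<phi> (at x) = (\<lambda>v. gradient \<phi> x \<bullet> v)" for x
    using frechet_derivative_at[OF has_derivative_gradient[OF smooth_differentiable[OF assms]]] by simp
  then have "gradient \<phi> = (\<lambda>x. \<Sum>b\<in>Basis. frechet_derivative \<phi> (at x) b *\<^sub>R b)"
    by (simp add: euclidean_representation)
  then show ?thesis
    using cont by (simp add: continuous_intros)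
qed

section \<open>Solutions on intervals and growth of functions along them\<close>

lemma solution_on_subset:
  "solution_on F I x \<Longrightarrow> J \<subseteq> I \<Longrightarrow> is_interval J \<Longrightarrow> solution_on F J x"
  unfolding solution_on_def by (meson has_vector_derivative_within_subset subsetD)

lemma solution_on_continuous: "solution_on F I x \<Longrightarrow> continuous_on I x"
  unfolding solution_on_def
  by (meson continuous_on_eq_continuous_within has_vector_derivative_continuous)

lemma interval_Icc_subset:
  fixes I :: "real set"
  shows "is_interval I \<Longrightarrow> a \<in> I \<Longrightarrow> b \<in> I \<Longrightarrow> {a..b} \<subseteq> I"
  by (meson atLeastAtMost_iff mem_is_interval_1_I subsetI)

lemma solution_on_Icc:
  assumes "solution_on F I x" "a \<in> I" "b \<in> I"
  shows "solution_on F {a..b} x"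
  using assms interval_Icc_subset[of I a b] solution_on_subset[OF assms(1), of "{a..b}"]
  by (auto simp: solution_on_def)

lemma has_derivative_along_solution:
  fixes \<phi> :: "'a::euclidean_space \<Rightarrow> real"
  assumes "\<phi> differentiable at (x t)" "solution_on F I x" "t \<in> I"
  shows "((\<lambda>t. \<phi> (x t)) has_real_derivative gradient \<phi> (x t) \<bullet> F (x t)) (at t within I)"
proof -
  have "(x has_derivative (\<lambda>s. s *\<^sub>R F (x t))) (at t within I)"
    using assms(2,3) by (simp add: solution_on_def has_vector_derivative_def)
  from has_derivative_compose[OF this has_derivative_gradient[OF assms(1)]]
  show ?thesis
    by (simp add: has_field_derivative_def mult.commute[of _ "gradient \<phi> (x t) \<bullet> F (x t)"])
qed

text \<open>Mean value theorem for \<phi> along the solution. Asking for the bound only strictly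
  inside the interval lets it be applied up to, or from, a crossing time.\<close>

lemma solution_growth_bound:
  fixes \<phi> :: "'a::euclidean_space \<Rightarrow> real"
  assumes sol: "solution_on F {a..b} x" and "a \<le> b"
    and diff: "\<And>z. \<phi> differentiable at z"
    and bound: "\<And>t. a < t \<Longrightarrow> t < b \<Longrightarrow> gradient \<phi> (x t) \<bullet> F (x t) \<le> c"
  shows "\<phi> (x b) - \<phi> (x a) \<le> c * (b - a)"
proof (cases "a = b")
  case False
  with \<open>a \<le> b\<close> have "a < b" by simp
  then obtain t where t: "t \<in> {a<..<b}"
    "\<phi> (x b) - \<phi> (x a) = (gradient \<phi> (x t) \<bullet> F (x t)) * (b - a)"
    using mvt_simple[of a b "\<lambda>t. \<phi> (x t)" "\<lambda>t. (*) (gradient \<phi> (x t) \<bullet> F (x t))"]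
      has_derivative_along_solution[OF diff sol] unfolding has_field_derivative_def by auto
  then show ?thesis
    using bound[of t] \<open>a < b\<close> by (simp add: mult_right_mono)
qed simp

text \<open>After the last time with \<open>h \<ge> 0\<close> the value stays negative, hence cannot
  decrease; it therefore never gets below its nonnegative value at that time.\<close>

lemma forward_invariant_barrier:
  fixes h :: "'a::euclidean_space \<Rightarrow> real"
  assumes diff: "\<And>z. h differentiable at z"
    and incr: "\<And>z. h z < 0 \<Longrightarrow> gradient h z \<bullet> F z \<ge> 0"
  shows "forward_invariant F (safe_set h)"
  unfolding forward_invariant_def safe_set_def
proof (intro allI impI ballI, elim conjE)
  fix I x t\<^sub>0 t
  assume sol: "solution_on F I x" and I: "t\<^sub>0 \<in> I" "t \<in> I" "t\<^sub>0 \<le> t" and start: "x t\<^sub>0 \<in> {z. 0 \<le> h z}"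
  show "x t \<in> {z. 0 \<le> h z}"
  proof (rule ccontr)
    assume "x t \<notin> {z. 0 \<le> h z}"
    then have neg: "h (x t) < 0" by simp
    have sol: "solution_on F {t\<^sub>0..t} x"
      using solution_on_Icc[OF sol] I by simp
    have "continuous_on {t\<^sub>0..t} (\<lambda>s. h (x s))"
      using has_derivative_along_solution[OF diff sol] DERIV_continuous
      by (metis continuous_on_eq_continuous_within)
    then have "closed ({t\<^sub>0..t} \<inter> (\<lambda>s. h (x s)) -` {0..})"
      by (rule continuous_closed_preimage) auto
    moreover have "{t\<^sub>0..t} \<inter> (\<lambda>s. h (x s)) -` {0..} = {s \<in> {t\<^sub>0..t}. h (x s) \<ge> 0}"
      by auto
    ultimately have "compact {s \<in> {t\<^sub>0..t}. h (x s) \<ge> 0}"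
      by (auto simp: compact_eq_bounded_closed intro: bounded_subset[of "{t\<^sub>0..t}"])
    moreover have "{s \<in> {t\<^sub>0..t}. h (x s) \<ge> 0} \<noteq> {}"
      using start I by auto
    ultimately obtain s where s: "s \<in> {t\<^sub>0..t}" "h (x s) \<ge> 0"
      and last: "\<And>s'. s' \<in> {t\<^sub>0..t} \<Longrightarrow> h (x s') \<ge> 0 \<Longrightarrow> s' \<le> s"
      using compact_attains_sup[of "{s \<in> {t\<^sub>0..t}. h (x s) \<ge> 0}"] by auto
    have sub: "solution_on F {s..t} x"
      using solution_on_Icc[OF sol, of s t] s I by auto
    \<comment> \<open>The growth bound is an upper bound, so it is applied to
      \<open>- h\<close>.\<close>
    have "gradient (\<lambda>z. - h z) (x r) \<bullet> F (x r) \<le> 0" if r: "s < r" "r < t" for r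
    proof -
      have "h (x r) < 0"
        using last[of r] r s by (force simp: not_le[symmetric])
      moreover have "gradient (\<lambda>z. - h z) (x r) \<bullet> v = - (gradient h (x r) \<bullet> v)" for v
        using fun_cong[OF has_derivative_unique[OF has_derivative_gradient[of "\<lambda>z. - h z" "x r"]
            has_derivative_minus[OF has_derivative_gradient[OF diff[of "x r"]]]], of v] diff
        by simp
      ultimately show ?thesis
        using incr by simp
    qed
    then have "- h (x t) - - h (x s) \<le> 0 * (t - s)"
      using s diff by (intro solution_growth_bound[OF sub]) auto
    then show False
      using neg s by simp
  qed
qed

section \<open>The quadratic program\<close>

text \<open>Scaling \<delta> by \<open>sqrt p\<close> turns the cost into half the squared Euclidean
  norm, so a minimiser is the point nearest to the origin in a nonempty closed set, here
  \<open>?T\<close>.\<close>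

lemma qp_solution_optimal:
  fixes g :: "real^'n \<Rightarrow> real^'m^'n"
  assumes "p > 0" and ne: "qp_feasible f g V h \<gamma> \<alpha> x \<noteq> {}"
  shows "qp_solution f g V h \<gamma> \<alpha> p x \<in> qp_feasible f g V h \<gamma> \<alpha> x"
    and "\<And>z. z \<in> qp_feasible f g V h \<gamma> \<alpha> x \<Longrightarrow>
      qp_cost p (qp_solution f g V h \<gamma> \<alpha> p x) \<le> qp_cost p z"
proof -
  let ?S = "qp_feasible f g V h \<gamma> \<alpha> x"
  let ?T = "{z. (fst z, snd z / sqrt p) \<in> ?S}"
  have cost: "qp_cost p (v, \<delta>) = 1/2 * (norm (v, sqrt p * \<delta>))\<^sup>2" for v :: "real^'m" and \<delta>
    using \<open>p > 0\<close> by (simp add: qp_cost_def norm_Pair power_mult_distrib distrib_left)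
  have "closed ?T"
    unfolding qp_feasible_def case_prod_unfold mem_Collect_eq
    using \<open>p > 0\<close> by (intro closed_Collect_conj closed_Collect_le continuous_intros) auto
  moreover obtain v \<delta> where "(v, \<delta>) \<in> ?S"
    using ne by auto
  then have "(v, sqrt p * \<delta>) \<in> ?T"
    using \<open>p > 0\<close> by simp
  then have "?T \<noteq> {}" by blast
  ultimately obtain w where w: "w \<in> ?T" "\<And>y. y \<in> ?T \<Longrightarrow> dist 0 w \<le> dist 0 y"
    using distance_attains_inf[of ?T 0] by blast
  define z where "z = (fst w, snd w / sqrt p)"
  have "qp_cost p z \<le> qp_cost p y" if "y \<in> ?S" for y
  proof -
    have "norm w \<le> norm (fst y, sqrt p * snd y)"
      using w(2)[of "(fst y, sqrt p * snd y)"] that \<open>p > 0\<close> by simp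
    then have "(norm w)\<^sup>2 \<le> (norm (fst y, sqrt p * snd y))\<^sup>2"
      by (simp add: power_mono)
    moreover have "qp_cost p z = 1/2 * (norm w)\<^sup>2"
      using cost[of "fst z" "snd z"] \<open>p > 0\<close> by (simp add: z_def)
    ultimately show ?thesis
      using cost[of "fst y" "snd y"] unfolding prod.collapse by linarith
  qed
  then have "is_arg_min (qp_cost p) (\<lambda>y. y \<in> ?S) z"
    using w(1) by (auto simp: is_arg_min_linorder z_def)
  \<comment> \<open>\<open>arg_min\<close> is a Hilbert choice; one existing minimiser makes the
    chosen point a minimiser too.\<close>
  then have "is_arg_min (qp_cost p) (\<lambda>y. y \<in> ?S) (qp_solution f g V h \<gamma> \<alpha> p x)"
    unfolding qp_solution_def arg_min_on_def arg_min_def by (rule someI)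
  then show "qp_solution f g V h \<gamma> \<alpha> p x \<in> ?S"
    and "\<And>z. z \<in> ?S \<Longrightarrow> qp_cost p (qp_solution f g V h \<gamma> \<alpha> p x) \<le> qp_cost p z"
    by (auto simp: is_arg_min_linorder)
qed

text \<open>The point \<open>(0, 0)\<close> has cost 0, and the cost is a sum of nonnegative
  terms.\<close>

lemma qp_solution_zero:
  fixes g :: "real^'n \<Rightarrow> real^'m^'n"
  assumes "p > 0" "(0, 0) \<in> qp_feasible f g V h \<gamma> \<alpha> x"
  shows "fst (qp_solution f g V h \<gamma> \<alpha> p x) = 0"
proof -
  obtain v \<delta> where z: "qp_solution f g V h \<gamma> \<alpha> p x = (v, \<delta>)"
    by fastforce
  have "qp_cost p (v, \<delta>) \<le> qp_cost p (0 :: real^'m, 0)"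
    using qp_solution_optimal(2)[OF assms(1) _ assms(2)] assms(2) z by (metis empty_iff)
  then have "(norm v)\<^sup>2 + p * \<delta>\<^sup>2 \<le> 0"
    by (simp add: qp_cost_def)
  moreover have "p * \<delta>\<^sup>2 \<ge> 0" using assms by simp
  ultimately show ?thesis
    using z by (simp add: power2_eq_square) (smt (verit) mult_eq_0_iff norm_eq_zero zero_le_square)
qed

text \<open>By convexity a constraint that is inactive at the minimiser can be dropped.\<close>

lemma qp_solution_inactive_barrier:
  fixes v :: "real^'m"
  assumes "p > 0" "lie_f f V x + \<gamma> (V x) \<le> 0"
    and feas: "qp_feasible f g V h \<gamma> \<alpha> x \<noteq> {}"
    and v: "v = fst (qp_solution f g V h \<gamma> \<alpha> p x)"
    and inact: "lie_f f h x + lie_g g h x \<bullet> v + \<alpha> (h x) > 0"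
  shows "v = 0"
proof -
  obtain \<delta> where z: "qp_solution f g V h \<gamma> \<alpha> p x = (v, \<delta>)"
    using v by (metis prod.collapse)
  have clf: "lie_f f V x + lie_g g V x \<bullet> v + \<gamma> (V x) \<le> \<delta>"
    using qp_solution_optimal(1)[OF assms(1) feas] z by (simp add: qp_feasible_def)
  define c where "c = lie_f f h x + \<alpha> (h x)"
  define k where "k = lie_g g h x \<bullet> v"
  \<comment> \<open>Shrink the minimiser towards the origin by a factor \<open>s\<close> just below
    1: by continuity the inactive barrier constraint still holds.\<close>
  have "((\<lambda>s. c + s * k) \<longlongrightarrow> c + 1 * k) (at_left 1)"
    by (intro tendsto_intros)
  moreover have "c + 1 * k > 0" using inact by (simp add: c_def k_def)
  ultimately have "eventually (\<lambda>s. c + s * k > 0) (at_left (1::real))"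
    by (rule order_tendstoD)
  moreover have "eventually (\<lambda>s::real. 0 < s \<and> s < 1) (at_left 1)"
    using eventually_at_left_real[of 0 1] by (auto elim: eventually_mono)
  ultimately have "eventually (\<lambda>s. c + s * k > 0 \<and> 0 < s \<and> s < 1) (at_left (1::real))"
    by (rule eventually_conj)
  then obtain s where s: "c + s * k > 0" "0 < s" "s < 1"
    using eventually_happens by force
  \<comment> \<open>The CLF constraint is affine and holds at \<open>(0, 0)\<close> and at the
    minimiser, hence at the convex combination.\<close>
  have "lie_f f V x + lie_g g V x \<bullet> (s *\<^sub>R v) + \<gamma> (V x) =
      (1 - s) * (lie_f f V x + \<gamma> (V x)) + s * (lie_f f V x + lie_g g V x \<bullet> v + \<gamma> (V x))"
    by (simp add: algebra_simps)
  also have "\<dots> \<le> 0 + s * \<delta>"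
    using s clf assms(2) by (intro add_mono mult_left_mono mult_nonneg_nonpos) auto
  finally have "(s *\<^sub>R v, s * \<delta>) \<in> qp_feasible f g V h \<gamma> \<alpha> x"
    using s by (simp add: qp_feasible_def c_def k_def algebra_simps)
  then have "qp_cost p (v, \<delta>) \<le> qp_cost p (s *\<^sub>R v, s * \<delta>)"
    using qp_solution_optimal(2)[OF assms(1) feas] z by metis
  \<comment> \<open>The cost is homogeneous of degree two, so shrinking would beat the minimiser
    unless its cost is 0.\<close>
  also have "\<dots> = s\<^sup>2 * qp_cost p (v, \<delta>)"
    using s by (simp add: qp_cost_def power_mult_distrib algebra_simps)
  finally have "(1 - s\<^sup>2) * qp_cost p (v, \<delta>) \<le> 0"
    by (simp add: algebra_simps)
  moreover have "s\<^sup>2 < 1"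
    using s by (simp add: power_less_one_iff)
  ultimately have "(norm v)\<^sup>2 + p * \<delta>\<^sup>2 \<le> 0"
    by (simp add: qp_cost_def mult_le_0_iff)
  then show ?thesis
    using assms(1) by (smt (verit) mult_nonneg_nonneg zero_le_power2 norm_eq_zero zero_eq_power2)
qed

section \<open>Global existence for bounded Lipschitz fields\<close>

text \<open>The fundamental theorem on a half-line, obtained from a compact interval because
  \<open>{a..t + 1}\<close> and \<open>{a..}\<close> agree near \<open>t\<close>.\<close>

lemma integral_has_vector_derivative_at_least:
  fixes G :: "real \<Rightarrow> 'a::banach"
  assumes "continuous_on {a..} G" "a \<le> t"
  shows "((\<lambda>t. integral {a..t} G) has_vector_derivative G t) (at t within {a..})"
proof -
  have "((\<lambda>t. integral {a..t} G) has_vector_derivative G t) (at t within {a..t + 1})"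
    using assms by (intro integral_has_vector_derivative continuous_on_subset[OF assms(1)]) auto
  moreover have "at t within {a..t + 1} = at t within {a..}"
    by (rule at_within_nhd[of _ "{..<t + 1}"]) auto
  ultimately show ?thesis by simp
qed

text \<open>Picard iteration in the space of bounded functions \<open>y t = exp (- k (t - t\<^sub>0)) x t\<close>: for
  \<open>k > L\<close> the weight makes the integral operator a contraction on the whole half-line at once.\<close>

lemma bounded_lipschitz_solution_exists:
  fixes F :: "'a::euclidean_space \<Rightarrow> 'a"
  assumes lip: "L-lipschitz_on UNIV F" and bdd: "\<And>z. norm (F z) \<le> M"
  shows "\<exists>x. solution_on F {t\<^sub>0..} x \<and> x t\<^sub>0 = x\<^sub>0"
proof -
  have "L \<ge> 0" using lipschitz_on_nonneg[OF lip] .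
  have "M \<ge> 0" using bdd norm_ge_zero order_trans by blast
  \<comment> \<open>This gives \<open>L / k < 1\<close> for the contraction and
    \<open>k \<ge> 1\<close> for the growth estimate.\<close>
  define k where "k = L + 1"
  have k: "k \<ge> 1" using \<open>L \<ge> 0\<close> by (simp add: k_def)
  define w where "w t = exp (k * (t - t\<^sub>0))" for t
  have w_pos: "w t > 0" for t by (simp add: w_def)
  have w_cont: "continuous_on S w" for S
    unfolding w_def by (intro continuous_intros)
  define G where "G y s = F (w s *\<^sub>R apply_bcontfun y s)" for y :: "real \<Rightarrow>\<^sub>C 'a" and s
  have F_cont: "continuous_on S F" for S
    using lipschitz_on_continuous_on[OF lip] continuous_on_subset by blast
  have G_cont: "continuous_on S (G y)" for S y
    unfolding G_def
    by (intro continuous_on_compose2[OF F_cont[of UNIV]] continuous_intros w_cont) auto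
  have G_int: "G y integrable_on {a..b}" for y a b
    using G_cont by (rule integrable_continuous_real)
  define X where "X y t = x\<^sub>0 + integral {t\<^sub>0..t} (G y)" for y t
  have X_deriv: "(X y has_vector_derivative G y t) (at t within {t\<^sub>0..})" if "t \<ge> t\<^sub>0" for y t
    unfolding X_def
    using integral_has_vector_derivative_at_least[OF G_cont that]
    by (auto intro!: derivative_eq_intros)
  then have X_cont: "continuous_on {t\<^sub>0..} (X y)" for y
    unfolding continuous_on_eq_continuous_within
    by (metis atLeast_iff has_vector_derivative_continuous)
  \<comment> \<open>The weighted Picard iterate, frozen before the initial time so that it is a
    continuous function on the whole line.\<close>
  define T where "T y t = inverse (w (max t\<^sub>0 t)) *\<^sub>R X y (max t\<^sub>0 t)" for y t
  have T_bcontfun: "T y \<in> bcontfun" for y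
  proof (rule bcontfun_normI)
    show "continuous_on UNIV (T y)"
      unfolding T_def using w_pos
      by (intro continuous_intros continuous_on_compose2[OF X_cont]
          continuous_on_compose2[OF w_cont[of UNIV]]) (auto simp: less_imp_neq[symmetric])
    \<comment> \<open>Boundedness of \<open>F\<close> makes the iterate grow at most linearly, and
      the exponential weight dominates that.\<close>
    show "norm (T y t) \<le> norm x\<^sub>0 + M" for t
    proof -
      define s where "s = max t\<^sub>0 t"
      have s: "s \<ge> t\<^sub>0" by (simp add: s_def)
      have "norm (integral {t\<^sub>0..s} (G y)) \<le> M * (s - t\<^sub>0)"
        using s bdd by (intro integral_bound G_cont) (auto simp: G_def)
      also have "\<dots> \<le> M * w s"
      proof (rule mult_left_mono[OF _ \<open>M \<ge> 0\<close>])
        have "s - t\<^sub>0 \<le> k * (s - t\<^sub>0)"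
          using k s by (simp add: mult_le_cancel_right1)
        then show "s - t\<^sub>0 \<le> w s"
          using exp_ge_add_one_self[of "k * (s - t\<^sub>0)"] unfolding w_def by linarith
      qed
      finally have "norm (X y s) \<le> norm x\<^sub>0 + M * w s"
        unfolding X_def by (metis add_left_mono norm_triangle_ineq order_trans)
      moreover have "w s \<ge> 1"
        using k s by (simp add: w_def)
      then have "norm x\<^sub>0 \<le> norm x\<^sub>0 * w s"
        by (simp add: mult_le_cancel_left1)
      ultimately have "norm (X y s) \<le> (norm x\<^sub>0 + M) * w s"
        by (simp add: algebra_simps)
      then show ?thesis
        using w_pos[of s] by (simp add: T_def s_def[symmetric] divide_simps)
    qed
  qed
  define P where "P y = Bcontfun (T y)" for y
  have P: "apply_bcontfun (P y) = T y" for y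
    unfolding P_def using T_bcontfun by (rule Bcontfun_inverse)
  have "dist (P y) (P z) \<le> L / k * dist y z" for y z
  proof (rule dist_bound)
    fix t
    define s where "s = max t\<^sub>0 t"
    have s: "s \<ge> t\<^sub>0" by (simp add: s_def)
    have G_diff: "norm (G y r - G z r) \<le> L * dist y z * w r" for r
    proof -
      have "norm (G y r - G z r) \<le> L * norm (w r *\<^sub>R apply_bcontfun y r - w r *\<^sub>R apply_bcontfun z r)"
        using lipschitz_onD[OF lip] by (simp add: G_def dist_norm)
      also have "\<dots> = L * (w r * dist (apply_bcontfun y r) (apply_bcontfun z r))"
        using w_pos[of r] by (simp add: dist_norm scaleR_diff_right[symmetric])
      also have "\<dots> \<le> L * (w r * dist y z)"
        using \<open>L \<ge> 0\<close> w_pos[of r] dist_bounded[of y r z] by (intro mult_left_mono) auto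
      finally show ?thesis by (simp add: ac_simps)
    qed
    \<comment> \<open>Integrating the weight gains the factor \<open>1 / k\<close>, which beats the
      Lipschitz constant.\<close>
    have "((\<lambda>r. L * dist y z / k * w r) has_vector_derivative L * dist y z * w r)
        (at r within {t\<^sub>0..s})" for r
      unfolding w_def has_real_derivative_iff_has_vector_derivative[symmetric]
      using k by (auto intro!: derivative_eq_intros)
    then have "((\<lambda>r. L * dist y z * w r) has_integral
        L * dist y z / k * w s - L * dist y z / k * w t\<^sub>0) {t\<^sub>0..s}"
      using s by (intro fundamental_theorem_of_calculus) auto
    then have "norm (integral {t\<^sub>0..s} (\<lambda>r. G y r - G z r)) \<le>
        L * dist y z / k * w s - L * dist y z / k * w t\<^sub>0"
      using G_diff integral_norm_bound_integral[OF integrable_diff[OF G_int G_int] has_integral_integrable]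
      by (metis (no_types, lifting) integral_unique)
    also have "\<dots> \<le> L * dist y z / k * w s"
      using w_pos[of t\<^sub>0] \<open>L \<ge> 0\<close> k by simp
    finally have "norm (X y s - X z s) \<le> L * dist y z / k * w s"
      by (simp add: X_def integral_diff[OF G_int G_int])
    then have "inverse (w s) * norm (X y s - X z s) \<le> L / k * dist y z"
      using w_pos[of s] k by (simp add: divide_simps split: if_splits)
    then show "dist (apply_bcontfun (P y) t) (apply_bcontfun (P z) t) \<le> L / k * dist y z"
      using w_pos[of s]
      by (simp add: P T_def s_def[symmetric] dist_norm scaleR_diff_right[symmetric])
  qed
  moreover have "0 \<le> L / k" "L / k < 1"
    using \<open>L \<ge> 0\<close> by (auto simp: k_def)
  ultimately obtain y where y: "P y = y"
    using banach_fix_type[of "L / k" P] by blast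
  \<comment> \<open>Removing the weight from the fixed point shows that \<open>X y\<close> satisfies
    the integral equation.\<close>
  have "w t *\<^sub>R apply_bcontfun y t = X y t" if "t \<ge> t\<^sub>0" for t
    using P[of y] y w_pos[of t] that by (simp add: T_def max_absorb2)
  then have "G y t = F (X y t)" if "t \<ge> t\<^sub>0" for t
    using that by (simp add: G_def)
  then have "(X y has_vector_derivative F (X y t)) (at t within {t\<^sub>0..})" if "t \<ge> t\<^sub>0" for t
    using X_deriv[of t y] that by simp
  then have "solution_on F {t\<^sub>0..} (X y)"
    by (simp add: solution_on_def is_interval_1)
  moreover have "X y t\<^sub>0 = x\<^sub>0"
    by (simp add: X_def)
  ultimately show ?thesis by blast
qed

section \<open>Lyapunov's direct method\<close>

lemma class_K_strict_mono: "class_K \<gamma> \<Longrightarrow> 0 \<le> a \<Longrightarrow> a < b \<Longrightarrow> \<gamma> a < \<gamma> b"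
  unfolding class_K_def by (auto elim!: strict_mono_onD)

lemma class_K_mono: "class_K \<gamma> \<Longrightarrow> 0 \<le> a \<Longrightarrow> a \<le> b \<Longrightarrow> \<gamma> a \<le> \<gamma> b"
  by (cases "a = b") (auto dest: class_K_strict_mono[of \<gamma> a b])

text \<open>\<open>V\<close> has a positive minimum on the sphere of radius \<epsilon>, and a start
  close to 0 has a smaller value, which cannot increase inside the ball. Since \<eta> depends on
  \<open>V\<close> and \<epsilon> alone, it serves several fields at once.\<close>

lemma lyapunov_confinement:
  fixes V :: "'a::euclidean_space \<Rightarrow> real"
  assumes diff: "\<And>z. V differentiable at z" and V0: "V 0 = 0" and Vpos: "\<And>z. z \<noteq> 0 \<Longrightarrow> V z > 0"
    and "\<epsilon> > 0"
  obtains \<eta> where "\<eta> > 0" "\<And>F I x t\<^sub>0 t. solution_on F I x \<Longrightarrow>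
    (\<And>z. norm z \<le> \<epsilon> \<Longrightarrow> gradient V z \<bullet> F z \<le> 0) \<Longrightarrow> norm (x t\<^sub>0) < \<eta> \<Longrightarrow>
    t\<^sub>0 \<in> I \<Longrightarrow> t \<in> I \<Longrightarrow> t\<^sub>0 \<le> t \<Longrightarrow> norm (x t) < \<epsilon>"
proof -
  have V_cont: "continuous_on S V" for S
    using diff by (meson continuous_at_imp_continuous_on differentiable_imp_continuous_within)
  have "sphere (0::'a) \<epsilon> \<noteq> {}"
    using \<open>\<epsilon> > 0\<close> by simp
  then obtain b where b: "b \<in> sphere 0 \<epsilon>" "\<And>z. z \<in> sphere 0 \<epsilon> \<Longrightarrow> V b \<le> V z"
    using continuous_attains_inf[OF compact_sphere _ V_cont, of 0 \<epsilon>] by blast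
  then have "V b > 0"
    using \<open>\<epsilon> > 0\<close> by (intro Vpos) auto
  then have "0 \<in> {z. V z < V b}"
    using V0 by simp
  moreover have "open {z. V z < V b}"
    by (intro open_Collect_less V_cont continuous_on_const)
  ultimately obtain \<eta>' where \<eta>': "\<eta>' > 0" "\<And>z. norm z < \<eta>' \<Longrightarrow> V z < V b"
    by (force elim!: openE simp: subset_iff)
  \<comment> \<open>The start must also lie inside the ball, so that leaving it means crossing the
    sphere.\<close>
  define \<eta> where "\<eta> = min \<eta>' \<epsilon>"
  show ?thesis
  proof
    show "\<eta> > 0" using \<eta>' \<open>\<epsilon> > 0\<close> by (simp add: \<eta>_def)
    fix F I x t\<^sub>0 t
    assume sol: "solution_on F I x" and dec: "\<And>z. norm z \<le> \<epsilon> \<Longrightarrow> gradient V z \<bullet> F z \<le> 0"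
      and start: "norm (x t\<^sub>0) < \<eta>" and I: "t\<^sub>0 \<in> I" "t \<in> I" "t\<^sub>0 \<le> t"
    show "norm (x t) < \<epsilon>"
    proof (rule ccontr)
      assume far: "\<not> norm (x t) < \<epsilon>"
      have sol: "solution_on F {t\<^sub>0..t} x"
        using solution_on_Icc[OF sol] I by simp
      have cont: "continuous_on {t\<^sub>0..t} (\<lambda>s. norm (x s))"
        using solution_on_continuous[OF sol] by (rule continuous_on_norm)
      then have "closed ({t\<^sub>0..t} \<inter> (\<lambda>s. norm (x s)) -` {\<epsilon>..})"
        by (rule continuous_closed_preimage) auto
      moreover have "{t\<^sub>0..t} \<inter> (\<lambda>s. norm (x s)) -` {\<epsilon>..} = {s \<in> {t\<^sub>0..t}. norm (x s) \<ge> \<epsilon>}"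
        by auto
      ultimately have "compact {s \<in> {t\<^sub>0..t}. norm (x s) \<ge> \<epsilon>}"
        by (auto simp: compact_eq_bounded_closed intro: bounded_subset[of "{t\<^sub>0..t}"])
      moreover have "{s \<in> {t\<^sub>0..t}. norm (x s) \<ge> \<epsilon>} \<noteq> {}"
        using far I by auto
      ultimately obtain s where s: "s \<in> {t\<^sub>0..t}" "norm (x s) \<ge> \<epsilon>"
        and first: "\<And>s'. s' \<in> {t\<^sub>0..t} \<Longrightarrow> norm (x s') \<ge> \<epsilon> \<Longrightarrow> s \<le> s'"
        using compact_attains_inf[of "{s \<in> {t\<^sub>0..t}. norm (x s) \<ge> \<epsilon>}"] by auto
      \<comment> \<open>The intermediate value theorem gives a time on the sphere no later than the
        first exit time \<open>s\<close>, so the two coincide.\<close>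
      have "\<exists>r. t\<^sub>0 \<le> r \<and> r \<le> s \<and> norm (x r) = \<epsilon>"
        using s start continuous_on_subset[OF cont, of "{t\<^sub>0..s}"]
        by (intro IVT') (auto simp: \<eta>_def)
      then have "norm (x s) = \<epsilon>"
        using first s by (metis atLeastAtMost_iff order_antisym order_trans order_refl)
      then have "V b \<le> V (x s)"
        using b by simp
      have "V (x s) - V (x t\<^sub>0) \<le> 0 * (s - t\<^sub>0)"
      proof (rule solution_growth_bound[OF _ _ diff])
        show "solution_on F {t\<^sub>0..s} x"
          using solution_on_Icc[OF sol, of t\<^sub>0 s] s by auto
        show "gradient V (x r) \<bullet> F (x r) \<le> 0" if "t\<^sub>0 < r" "r < s" for r
          using first[of r] that s by (intro dec) force
      qed (use s in auto)
      moreover have "V (x t\<^sub>0) < V b"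
        using start \<eta>' by (simp add: \<eta>_def)
      ultimately show False
        using \<open>V b \<le> V (x s)\<close> by simp
    qed
  qed
qed

text \<open>On the shell \<open>e \<le> norm z \<le> r\<close>, \<open>V\<close> is at least some
  \<open>c > 0\<close>. As long as \<open>V \<ge> c\<close> it falls at rate at least
  \<open>\<gamma> c\<close>, so it drops below \<open>c\<close> in finite time; being nonincreasing
  it stays there, which keeps the solution out of the shell.\<close>

lemma lyapunov_convergence:
  fixes V :: "'a::euclidean_space \<Rightarrow> real"
  assumes diff: "\<And>z. V differentiable at z" and Vpos: "\<And>z. z \<noteq> 0 \<Longrightarrow> V z > 0"
    and V0: "V 0 = 0" and K: "class_K \<gamma>"
    and dec: "\<And>z. norm z \<le> r \<Longrightarrow> gradient V z \<bullet> F z \<le> - \<gamma> (V z)"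
    and sol: "solution_on F {t\<^sub>0..} x"
    and conf: "\<And>t. t \<ge> t\<^sub>0 \<Longrightarrow> norm (x t) \<le> r"
  shows "(x \<longlongrightarrow> 0) at_top"
proof (rule tendstoI)
  fix e :: real assume "e > 0"
  have V_cont: "continuous_on S V" for S
    using diff by (meson continuous_at_imp_continuous_on differentiable_imp_continuous_within)
  have V_nonneg: "V z \<ge> 0" for z
    using V0 Vpos by (metis less_eq_real_def)
  note \<gamma>_mono = class_K_mono[OF K]
  have \<gamma>_pos: "\<gamma> a > 0" if "a > 0" for a
    using class_K_strict_mono[OF K, of 0 a] K that by (simp add: class_K_def)
  have Icc: "solution_on F {a..b} x" if "t\<^sub>0 \<le> a" for a b
    using solution_on_subset[OF sol, of "{a..b}"] that by (auto simp: is_interval_cc)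
  obtain c where c: "c > 0" "\<And>z. norm z \<le> r \<Longrightarrow> e \<le> norm z \<Longrightarrow> c \<le> V z"
  proof (cases "cball 0 r - ball (0::'a) e = {}")
    case True
    then show ?thesis
      using that[of 1] by (force simp: set_eq_iff not_less)
  next
    case False
    moreover have "compact (cball 0 r - ball (0::'a) e)"
      by (intro compact_diff compact_cball open_ball)
    ultimately obtain z where z: "z \<in> cball 0 r - ball 0 e"
        "\<And>y. y \<in> cball 0 r - ball 0 e \<Longrightarrow> V z \<le> V y"
      using continuous_attains_inf[OF _ _ V_cont, of "cball 0 r - ball 0 e"] by blast
    then show ?thesis
      using that[of "V z"] Vpos[of z] \<open>e > 0\<close> by (force simp: not_less)
  qed
  have "\<exists>t\<ge>t\<^sub>0. V (x t) < c"
  proof (rule ccontr)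
    assume "\<not> ?thesis"
    then have large: "V (x t) \<ge> c" if "t \<ge> t\<^sub>0" for t
      using that by (meson not_less)
    \<comment> \<open>By this time a decrease at rate \<open>\<gamma> c\<close> has used up the
      whole initial value.\<close>
    define t where "t = t\<^sub>0 + V (x t\<^sub>0) / \<gamma> c"
    have "t \<ge> t\<^sub>0"
      using V_nonneg \<gamma>_pos[OF c(1)] by (simp add: t_def)
    then have "V (x t) - V (x t\<^sub>0) \<le> - \<gamma> c * (t - t\<^sub>0)"
      using large \<gamma>_mono c(1) conf
      by (intro solution_growth_bound[OF Icc _ diff] order_trans[OF dec]) auto
    then have "V (x t) \<le> 0"
      using \<gamma>_pos[OF c(1)] by (simp add: t_def)
    then show False
      using large[OF \<open>t \<ge> t\<^sub>0\<close>] c(1) by simp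
  qed
  then obtain t\<^sub>1 where t\<^sub>1: "t\<^sub>1 \<ge> t\<^sub>0" "V (x t\<^sub>1) < c" by blast
  have "dist (x t) 0 < e" if "t \<ge> t\<^sub>1" for t
  proof -
    have "V (x t) - V (x t\<^sub>1) \<le> 0 * (t - t\<^sub>1)"
    proof (rule solution_growth_bound[OF Icc that diff])
      show "gradient V (x s) \<bullet> F (x s) \<le> 0" if "t\<^sub>1 < s" for s
        using dec[of "x s"] conf[of s] \<gamma>_mono[of 0 "V (x s)"] V_nonneg[of "x s"] that t\<^sub>1 K
        by (simp add: class_K_def)
    qed (use t\<^sub>1 in auto)
    then show ?thesis
      using c(2)[of "x t"] conf[of t] t\<^sub>1 that by (force simp: not_le[symmetric])
  qed
  then show "\<forall>\<^sub>F t in at_top. dist (x t) 0 < e"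
    unfolding eventually_at_top_linorder by blast
qed

text \<open>That \<open>0\<close> is an equilibrium is not assumed: a solution starting at \<open>0\<close> is confined to every
  neighbourhood of \<open>0\<close>, hence constant. Global solutions are those of the field composed with the
  projection onto a ball, which never leave the ball.\<close>

lemma lyapunov_asymptotic_stability:
  fixes V :: "'a::euclidean_space \<Rightarrow> real"
  assumes diff: "\<And>z. V differentiable at z" and V0: "V 0 = 0" and Vpos: "\<And>z. z \<noteq> 0 \<Longrightarrow> V z > 0"
    and K: "class_K \<gamma>" and "r > 0"
    and dec: "\<And>z. norm z \<le> r \<Longrightarrow> gradient V z \<bullet> F z \<le> - \<gamma> (V z)"
    and lip: "L-lipschitz_on (cball 0 r) F"
  shows "locally_asymptotically_stable F 0"
proof -
  have V_nonneg: "V z \<ge> 0" for z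
    using V0 Vpos by (metis less_eq_real_def)
  have "\<gamma> (V z) \<ge> 0" for z
    using class_K_mono[OF K, of 0 "V z"] K V_nonneg[of z] by (simp add: class_K_def)
  then have dec0: "gradient V z \<bullet> F z \<le> 0" if "norm z \<le> r" for z
    using dec[OF that] by (smt (verit))
  have stable: "lyapunov_stable F 0"
    unfolding lyapunov_stable_def
  proof (intro allI impI)
    fix \<epsilon> :: real assume "\<epsilon> > 0"
    \<comment> \<open>The decrease of \<open>V\<close> is known only on the ball of radius
      \<open>r\<close>.\<close>
    then have "min \<epsilon> r > 0" using \<open>r > 0\<close> by simp
    then obtain \<eta> where \<eta>: "\<eta> > 0" "\<And>F I x t\<^sub>0 t. solution_on F I x \<Longrightarrow>
        (\<And>z. norm z \<le> min \<epsilon> r \<Longrightarrow> gradient V z \<bullet> F z \<le> 0) \<Longrightarrow> norm (x t\<^sub>0) < \<eta> \<Longrightarrow>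
        t\<^sub>0 \<in> I \<Longrightarrow> t \<in> I \<Longrightarrow> t\<^sub>0 \<le> t \<Longrightarrow> norm (x t) < min \<epsilon> r"
      using lyapunov_confinement[OF diff V0 Vpos] by blast
    have "norm (x t) < \<epsilon>"
      if "solution_on F I x" "t\<^sub>0 \<in> I" "norm (x t\<^sub>0) < \<eta>" "t \<in> I" "t\<^sub>0 \<le> t" for I x t\<^sub>0 t
      using \<eta>(2)[OF that(1) _ that(3,2,4,5)] dec0 by simp
    then show "\<exists>\<eta>>0. \<forall>I x t\<^sub>0. solution_on F I x \<and> t\<^sub>0 \<in> I \<and> dist (x t\<^sub>0) 0 < \<eta> \<longrightarrow>
        (\<forall>t\<in>I. t\<^sub>0 \<le> t \<longrightarrow> dist (x t) 0 < \<epsilon>)"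
      using \<eta>(1) by auto
  qed
  obtain \<eta> where \<eta>: "\<eta> > 0" "\<And>F I x t\<^sub>0 t. solution_on F I x \<Longrightarrow>
      (\<And>z. norm z \<le> r \<Longrightarrow> gradient V z \<bullet> F z \<le> 0) \<Longrightarrow> norm (x t\<^sub>0) < \<eta> \<Longrightarrow>
      t\<^sub>0 \<in> I \<Longrightarrow> t \<in> I \<Longrightarrow> t\<^sub>0 \<le> t \<Longrightarrow> norm (x t) < r"
    using lyapunov_confinement[OF diff V0 Vpos \<open>r > 0\<close>] by blast
  have exist: "\<exists>x. solution_on F {t\<^sub>0..} x \<and> x t\<^sub>0 = x\<^sub>0" if "norm x\<^sub>0 < \<eta>" for t\<^sub>0 x\<^sub>0
  proof -
    let ?\<pi> = "closest_point (cball (0::'a) r)"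
    let ?F = "\<lambda>z. F (?\<pi> z)"
    have ne: "cball (0::'a) r \<noteq> {}" using \<open>r > 0\<close> by simp
    have range: "?\<pi> z \<in> cball 0 r" for z
      using closest_point_in_set[OF closed_cball ne] .
    have id: "?\<pi> z = z" if "norm z \<le> r" for z
      using that by (simp add: closest_point_self)
    have "1-lipschitz_on UNIV ?\<pi>"
      using closest_point_lipschitz[OF convex_cball closed_cball ne] by (intro lipschitz_onI) auto
    then have lip': "(L * 1)-lipschitz_on UNIV ?F"
      using range by (intro lipschitz_on_compose2 lipschitz_on_subset[OF lip]) auto
    have "bounded (F ` cball 0 r)"
      using lipschitz_on_continuous_on[OF lip] compact_cball
      by (intro compact_imp_bounded compact_continuous_image)
    then obtain M where "\<And>z. norm (?F z) \<le> M"
      using range unfolding bounded_iff by blast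
    then obtain x where x: "solution_on ?F {t\<^sub>0..} x" "x t\<^sub>0 = x\<^sub>0"
      using bounded_lipschitz_solution_exists[OF lip'] by metis
    \<comment> \<open>Confinement is applied to the truncated field, which equals \<open>F\<close>
      on the ball.\<close>
    have "norm (x t) < r" if "t \<ge> t\<^sub>0" for t
      using \<eta>(2)[OF x(1), of t\<^sub>0 t] that x(2) \<open>norm x\<^sub>0 < \<eta>\<close> dec0 id by simp
    then have "?F (x t) = F (x t)" if "t \<ge> t\<^sub>0" for t
      using id that by (simp add: less_imp_le)
    then have "solution_on F {t\<^sub>0..} x"
      using x(1) by (simp add: solution_on_def)
    then show ?thesis using x(2) by blast
  qed
  have "F 0 = 0"
  proof -
    obtain x where x: "solution_on F {0..} x" "x 0 = 0"
      using exist[of 0 0] \<eta>(1) by auto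
    have x_zero: "x t = 0" if "t \<ge> 0" for t
    proof (rule ccontr)
      assume "x t \<noteq> 0"
      then have "norm (x t) > 0" by simp
      \<comment> \<open>Stability is used with the radius \<open>norm (x t)\<close>, which
        \<open>x t\<close> itself cannot stay below.\<close>
      then obtain \<delta> where "\<delta> > 0" and \<delta>: "\<forall>I x' t\<^sub>0. solution_on F I x' \<and> t\<^sub>0 \<in> I \<and> dist (x' t\<^sub>0) 0 < \<delta> \<longrightarrow>
          (\<forall>s\<in>I. t\<^sub>0 \<le> s \<longrightarrow> dist (x' s) 0 < norm (x t))"
        using stable unfolding lyapunov_stable_def by blast
      have "dist (x t) 0 < norm (x t)"
        using \<delta>[rule_format, of "{0..}" x 0 t] x that \<open>\<delta> > 0\<close> by simp
      then show False by simp
    qed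
    have "(x has_vector_derivative F 0) (at 0 within {0..})"
      using x by (auto simp: solution_on_def dest: bspec[of _ _ 0])
    then have "((\<lambda>_. 0) has_vector_derivative F 0) (at 0 within {0..})"
      using x_zero by (intro has_vector_derivative_transform[of 0 "{0..}" "\<lambda>_. 0" x]) simp_all
    \<comment> \<open>At an endpoint the derivative is one-sided; on a nondegenerate closed interval
      it is still unique.\<close>
    then have "((\<lambda>_. 0) has_vector_derivative F 0) (at 0 within {0..1})"
      by (rule has_vector_derivative_within_subset) auto
    then show ?thesis
      using vector_derivative_unique_within_closed_interval[of 0 1 0 "\<lambda>_. 0" "F 0" 0] by simp
  qed
  moreover have "locally_attractive F 0"
    unfolding locally_attractive_def
  proof (intro exI[of _ \<eta>] conjI allI impI \<eta>(1))
    fix t\<^sub>0 and x\<^sub>0 :: 'a assume "dist x\<^sub>0 0 < \<eta>"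
    then have x\<^sub>0: "norm x\<^sub>0 < \<eta>" by simp
    show "\<exists>x. solution_on F {t\<^sub>0..} x \<and> x t\<^sub>0 = x\<^sub>0"
      using exist[OF x\<^sub>0] .
    fix x assume x: "solution_on F {t\<^sub>0..} x \<and> x t\<^sub>0 = x\<^sub>0"
    then have "norm (x t) \<le> r" if "t \<ge> t\<^sub>0" for t
      using \<eta>(2)[of F "{t\<^sub>0..}" x t\<^sub>0 t] x\<^sub>0 that dec0 by simp
    then show "(x \<longlongrightarrow> 0) at_top"
      using x by (intro lyapunov_convergence[OF diff Vpos V0 K dec]) auto
  qed
  ultimately show ?thesis
    using stable by (simp add: locally_asymptotically_stable_def equilibrium_point_def)
qed

section \<open>Local Lipschitz continuity of the closed loop\<close>

text \<open>As for the product rule, insert the mixed term \<open>prod (f y) (g x)\<close>; each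
  difference is then paired with a bounded factor.\<close>

lemma (in bounded_bilinear) lipschitz_on_prod:
  assumes f: "C-lipschitz_on U f" and g: "D-lipschitz_on U g"
    and A: "\<And>x. x \<in> U \<Longrightarrow> norm (f x) \<le> A" and B: "\<And>x. x \<in> U \<Longrightarrow> norm (g x) \<le> B"
    and "A \<ge> 0" "B \<ge> 0"
  shows "\<exists>L. L-lipschitz_on U (\<lambda>x. prod (f x) (g x))"
proof -
  obtain K where K: "K \<ge> 0" "\<And>a b. norm (prod a b) \<le> norm a * norm b * K"
    using nonneg_bounded by blast
  have "C \<ge> 0" "D \<ge> 0"
    using lipschitz_on_nonneg f g by blast+
  have "norm (prod (f x) (g x) - prod (f y) (g y)) \<le> (C * B * K + A * D * K) * dist x y"
    if U: "x \<in> U" "y \<in> U" for x y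
  proof -
    have "prod (f x) (g x) - prod (f y) (g y) = prod (f x - f y) (g x) + prod (f y) (g x - g y)"
      by (simp add: diff_left diff_right)
    also have "norm \<dots> \<le> norm (f x - f y) * norm (g x) * K + norm (f y) * norm (g x - g y) * K"
      using K(2) by (intro norm_triangle_le add_mono)
    also have "\<dots> \<le> (C * dist x y) * B * K + A * (D * dist x y) * K"
      using lipschitz_onD[OF f U] lipschitz_onD[OF g U] A B U K(1) \<open>A \<ge> 0\<close> \<open>B \<ge> 0\<close>
        \<open>C \<ge> 0\<close> \<open>D \<ge> 0\<close>
      by (intro add_mono mult_mono mult_nonneg_nonneg) (auto simp: dist_norm)
    finally show ?thesis
      by (simp add: algebra_simps)
  qed
  then have "(C * B * K + A * D * K)-lipschitz_on U (\<lambda>x. prod (f x) (g x))"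
    using K(1) \<open>A \<ge> 0\<close> \<open>B \<ge> 0\<close> \<open>C \<ge> 0\<close> \<open>D \<ge> 0\<close> by (intro lipschitz_onI) (auto simp: dist_norm)
  then show ?thesis by blast
qed

lemma bounded_bilinear_matrix_vector_mult:
  "bounded_bilinear ((*v) :: real^'m^'n \<Rightarrow> real^'m \<Rightarrow> real^'n)"
  unfolding bilinear_conv_bounded_bilinear[symmetric] bilinear_def
  by (auto intro!: linearI simp: matrix_vector_right_distrib matrix_vector_mult_add_rdistrib
      matrix_vector_mult_scaleR scaleR_matrix_vector_assoc[symmetric])

lemma locally_lipschitz_on_cball:
  assumes "locally_lipschitz F"
  shows "\<exists>e>0. \<exists>L. L-lipschitz_on (cball x e) F"
proof -
  obtain e L where "e > 0" "\<And>s. s \<in> cball 0 e \<inter> (UNIV :: real set) \<Longrightarrow> L-lipschitz_on (cball x e \<inter> UNIV) F"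
    using local_lipschitzE[OF assms UNIV_I UNIV_I] by metis
  from this(1) this(2)[of 0] show ?thesis
    by auto
qed

text \<open>On a common closed ball, compactness bounds \<open>g\<close> and \<open>u\<close>, so
  their product is Lipschitz. Applied with the nominal input, this covers \<open>f'\<close>.\<close>

lemma closed_loop_lipschitz_on_cball:
  fixes f :: "real^'n \<Rightarrow> real^'n" and g :: "real^'n \<Rightarrow> real^'m^'n"
  assumes f: "locally_lipschitz f" and g: "locally_lipschitz g" and u: "locally_lipschitz u"
  shows "\<exists>e>0. \<exists>L. L-lipschitz_on (cball x e) (closed_loop f g u)"
proof -
  obtain e\<^sub>1 L\<^sub>1 where 1: "e\<^sub>1 > 0" "L\<^sub>1-lipschitz_on (cball x e\<^sub>1) f"
    using locally_lipschitz_on_cball[OF f] by blast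
  obtain e\<^sub>2 L\<^sub>2 where 2: "e\<^sub>2 > 0" "L\<^sub>2-lipschitz_on (cball x e\<^sub>2) g"
    using locally_lipschitz_on_cball[OF g] by blast
  obtain e\<^sub>3 L\<^sub>3 where 3: "e\<^sub>3 > 0" "L\<^sub>3-lipschitz_on (cball x e\<^sub>3) u"
    using locally_lipschitz_on_cball[OF u] by blast
  define e where "e = min e\<^sub>1 (min e\<^sub>2 e\<^sub>3)"
  have lip: "L\<^sub>1-lipschitz_on (cball x e) f" "L\<^sub>2-lipschitz_on (cball x e) g" "L\<^sub>3-lipschitz_on (cball x e) u"
    by (auto intro!: lipschitz_on_subset[OF 1(2)] lipschitz_on_subset[OF 2(2)]
        lipschitz_on_subset[OF 3(2)] simp: e_def)
  have bdd: "\<exists>B\<ge>0. \<forall>z\<in>cball x e. norm (G z) \<le> B" if "L-lipschitz_on (cball x e) G"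
    for L and G :: "real^'n \<Rightarrow> 'c::real_normed_vector"
  proof -
    have "bounded (G ` cball x e)"
      using lipschitz_on_continuous_on[OF that] compact_cball
      by (intro compact_imp_bounded compact_continuous_image)
    then show ?thesis
      unfolding bounded_pos by (metis imageI less_imp_le)
  qed
  obtain L where "L-lipschitz_on (cball x e) (\<lambda>z. g z *v u z)"
    using bounded_bilinear.lipschitz_on_prod[OF bounded_bilinear_matrix_vector_mult lip(2,3)]
      bdd[OF lip(2)] bdd[OF lip(3)] by metis
  then have "(L\<^sub>1 + L)-lipschitz_on (cball x e) (closed_loop f g u)"
    unfolding closed_loop_def using lip(1) by (intro lipschitz_on_add)
  moreover have "e > 0"
    using 1(1) 2(1) 3(1) by (simp add: e_def)
  ultimately show ?thesis by blast
qed

section \<open>Safety, equilibria and stability under the filtered input\<close>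

theorem theorem3:
  fixes f f' :: "real^'n \<Rightarrow> real^'n"
    and g :: "real^'n \<Rightarrow> real^'m^'n"
    and V h :: "real^'n \<Rightarrow> real"
    and \<gamma> \<alpha> :: "real \<Rightarrow> real"
    and u\<^sub>n\<^sub>o\<^sub>m u' u :: "real^'n \<Rightarrow> real^'m"
    and p :: real
  assumes "locally_lipschitz f"
    and "locally_lipschitz g"
    and "control_lyapunov_function f g \<gamma> V"
    and "control_barrier_function f g \<alpha> h"
    and "0 \<in> safe_interior h"
    and "locally_lipschitz u\<^sub>n\<^sub>o\<^sub>m"
    and "\<And>x. lie_f f V x + lie_g g V x \<bullet> u\<^sub>n\<^sub>o\<^sub>m x \<le> - \<gamma> (V x)"
    and "f' = (\<lambda>x. f x + g x *v u\<^sub>n\<^sub>o\<^sub>m x)"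
    and "p > 0"
    and "u' = (\<lambda>x. fst (qp_solution f' g V h \<gamma> \<alpha> p x))"
    and "(\<forall>x. lie_g g h x \<noteq> 0) \<or> {x. lie_f f' h x + \<alpha> (h x) = 0 \<and> lie_g g h x = 0} = {}"
    and "u = (\<lambda>x. u\<^sub>n\<^sub>o\<^sub>m x + u' x)"
  shows "forward_invariant (closed_loop f g u) (safe_set h) \<and>
    (\<forall>x\<in>safe_interior h. equilibrium_point (closed_loop f g u) x \<longrightarrow> x = 0) \<and>
    \<not> (\<exists>x\<in>safe_boundary h. lie_g g h x = 0 \<and> equilibrium_point (closed_loop f g u) x) \<and>
    locally_asymptotically_stable (closed_loop f g u) 0"
proof -
  let ?F = "closed_loop f g u"
  have V: "smooth V" "V 0 = 0" "\<And>x. x \<noteq> 0 \<Longrightarrow> V x > 0" and K: "class_K \<gamma>"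
    using assms(3) by (auto simp: control_lyapunov_function_def)
  have h: "smooth h" and \<alpha>: "strict_mono \<alpha>" "\<alpha> 0 = 0" "continuous_on UNIV \<alpha>"
    and cbf: "\<And>x. (SUP u. ereal (lie_f f h x + lie_g g h x \<bullet> u + \<alpha> (h x))) \<ge> 0"
    using assms(4) by (auto simp: control_barrier_function_def extended_class_K_def)
  have diff: "V differentiable at x" "h differentiable at x" for x
    using V(1) h by (simp_all add: smooth_differentiable)
  have f'_closed_loop: "f' = closed_loop f g u\<^sub>n\<^sub>o\<^sub>m"
    using assms(8) by (simp add: closed_loop_def fun_eq_iff)
  have F: "?F x = f' x + g x *v u' x" for x
    by (simp add: closed_loop_def assms(8,12) matrix_vector_right_distrib)
  have lie_f': "lie_f f' \<phi> x = lie_f f \<phi> x + lie_g g \<phi> x \<bullet> u\<^sub>n\<^sub>o\<^sub>m x" for \<phi> x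
    by (simp add: assms(8) lie_f_def lie_g_def dot_lmul_matrix inner_add_right)
  have lie_F: "gradient \<phi> x \<bullet> ?F x = lie_f f' \<phi> x + lie_g g \<phi> x \<bullet> u' x" for \<phi> x
    by (simp add: F lie_f_def lie_g_def dot_lmul_matrix inner_add_right)
  have clf: "lie_f f' V x \<le> - \<gamma> (V x)" for x
    using assms(7)[of x] by (simp add: lie_f')
  \<comment> \<open>The slack \<delta> is free, so only the barrier constraint matters. If
    \<open>L_g h\<close> vanishes, the CBF supremum is over a constant; otherwise an input along
    \<open>L_g h\<close> attains equality.\<close>
  have feas: "qp_feasible f' g V h \<gamma> \<alpha> x \<noteq> {}" for x
  proof -
    have "\<exists>v. lie_f f' h x + lie_g g h x \<bullet> v + \<alpha> (h x) \<ge> 0"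
    proof (cases "lie_g g h x = 0")
      case True
      then show ?thesis
        using cbf[of x] by (simp add: lie_f' zero_ereal_def)
    next
      case False
      let ?c = "lie_f f' h x + \<alpha> (h x)"
      have "lie_g g h x \<bullet> ((- ?c / (lie_g g h x \<bullet> lie_g g h x)) *\<^sub>R lie_g g h x) = - ?c"
        using False by simp
      then show ?thesis
        by (metis add.commute add.left_commute add.right_inverse order_refl)
    qed
    then show ?thesis
      unfolding qp_feasible_def by blast
  qed
  have barrier: "gradient h x \<bullet> ?F x \<ge> - \<alpha> (h x)" for x
    using qp_solution_optimal(1)[OF assms(9) feas, of x]
    by (auto simp: lie_F assms(10) qp_feasible_def case_prod_unfold)
  have "forward_invariant ?F (safe_set h)"
  proof (rule forward_invariant_barrier[OF diff(2)])
    fix x assume "h x < 0"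
    then have "\<alpha> (h x) < 0"
      using \<alpha>(1,2) by (metis strict_monoD)
    then show "gradient h x \<bullet> ?F x \<ge> 0"
      using barrier[of x] by simp
  qed
  moreover have "x = 0" if x: "x \<in> safe_interior h" "equilibrium_point ?F x" for x
  proof (rule ccontr)
    assume "x \<noteq> 0"
    have "\<alpha> (h x) > 0"
      using x(1) \<alpha>(1,2) unfolding safe_interior_def by (metis mem_Collect_eq strict_monoD)
    \<comment> \<open>Hence the barrier constraint has the value \<open>\<alpha> (h x) > 0\<close>
      at the minimiser.\<close>
    moreover have "lie_f f' h x + lie_g g h x \<bullet> u' x = 0"
      using x(2) lie_F[of h x] by (simp add: equilibrium_point_def)
    ultimately have "u' x = 0"
      using clf[of x]
      by (intro qp_solution_inactive_barrier[OF assms(9) _ feas[of x]]) (auto simp: assms(10))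
    then have "lie_f f' V x = 0"
      using x(2) lie_F[of V x] by (simp add: equilibrium_point_def)
    moreover have "\<gamma> (V x) > 0"
      using class_K_strict_mono[OF K _ V(3)[OF \<open>x \<noteq> 0\<close>]] K by (simp add: class_K_def)
    ultimately show False
      using clf[of x] by simp
  qed
  moreover have False
    if x: "x \<in> safe_boundary h" "lie_g g h x = 0" "equilibrium_point ?F x" for x
  proof -
    have "lie_f f' h x = 0"
      using x(2,3) lie_F[of h x] by (simp add: equilibrium_point_def)
    moreover have "\<alpha> (h x) = 0"
      using x(1) \<alpha>(2) by (simp add: safe_boundary_def)
    ultimately show False
      using assms(11) x(2) by auto
  qed
  moreover have "locally_asymptotically_stable ?F 0"
  proof -
    have f'_lip: "\<exists>e>0. \<exists>L. L-lipschitz_on (cball x e) f'" for x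
      unfolding f'_closed_loop by (rule closed_loop_lipschitz_on_cball[OF assms(1,2,6)])
    obtain e L where e: "e > 0" "L-lipschitz_on (cball 0 e) f'"
      using f'_lip by blast
    \<comment> \<open>Stated for any field agreeing with \<open>f'\<close> near 0: it is used first
      for \<open>f'\<close> itself, to learn that \<open>f' 0 = 0\<close>, and then for the closed
      loop.\<close>
    have stable: "locally_asymptotically_stable G 0"
      if "\<And>z. norm z \<le> r \<Longrightarrow> G z = f' z" "0 < r" "r \<le> e" for G r
    proof (rule lyapunov_asymptotic_stability[OF diff(1) V(2,3) K \<open>0 < r\<close>])
      show "gradient V z \<bullet> G z \<le> - \<gamma> (V z)" if "norm z \<le> r" for z
        using clf[of z] \<open>norm z \<le> r\<close> \<open>\<And>z. norm z \<le> r \<Longrightarrow> G z = f' z\<close> by (simp add: lie_f_def)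
      have "L-lipschitz_on (cball 0 r) f'"
        using \<open>r \<le> e\<close> by (intro lipschitz_on_subset[OF e(2)]) auto
      then show "L-lipschitz_on (cball 0 r) G"
        by (rule lipschitz_on_transform) (use that(1) in auto)
    qed
    have "f' 0 = 0"
      using stable[of e f'] e(1)
      by (simp add: locally_asymptotically_stable_def equilibrium_point_def)
    \<comment> \<open>The value of the barrier constraint at input 0; since \<open>f' 0 = 0\<close>,
      it equals \<open>\<alpha> (h 0) > 0\<close> at the origin and stays positive nearby by
      continuity.\<close>
    define d where "d x = lie_f f' h x + \<alpha> (h x)" for x
    have "d 0 > 0"
      using assms(5) strict_monoD[OF \<alpha>(1), of 0 "h 0"] \<alpha>(2) \<open>f' 0 = 0\<close>
      by (simp add: d_def lie_f_def safe_interior_def)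
    have "isCont h 0"
      using diff(2) by (rule differentiable_imp_continuous_within)
    moreover have "isCont \<alpha> (h 0)"
      using \<alpha>(3) by (simp add: continuous_on_eq_continuous_at)
    ultimately have "isCont (\<lambda>x. \<alpha> (h x)) 0"
      by (rule isCont_o2)
    moreover have "isCont (gradient h) 0"
      using smooth_continuous_gradient[OF h] by (simp add: continuous_on_eq_continuous_at)
    moreover have "isCont f' 0"
      using lipschitz_on_continuous_on[OF e(2)] e(1) by (simp add: continuous_on_interior)
    ultimately have "isCont d 0"
      unfolding d_def lie_f_def by (intro continuous_add continuous_inner)
    then have "eventually (\<lambda>x. d x > 0) (nhds 0)"
      using order_tendstoD(1)[OF _ \<open>d 0 > 0\<close>] by (simp add: isCont_def tendsto_at_iff_tendsto_nhds)
    then obtain r\<^sub>0 where r\<^sub>0: "r\<^sub>0 > 0" "\<And>x. norm x < r\<^sub>0 \<Longrightarrow> d x > 0"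
      unfolding eventually_nhds_metric by auto
    \<comment> \<open>Halving \<open>r\<^sub>0\<close> fits a closed ball into the open one where
      \<open>d\<close> is positive.\<close>
    have "?F x = f' x" if "norm x \<le> min e (r\<^sub>0 / 2)" for x
    proof -
      have "d x > 0"
        using that r\<^sub>0(1) by (intro r\<^sub>0(2)) auto
      then have "(0, 0) \<in> qp_feasible f' g V h \<gamma> \<alpha> x"
        using clf[of x] by (simp add: qp_feasible_def d_def)
      then have "u' x = 0"
        using qp_solution_zero[OF assms(9)] by (simp add: assms(10))
      then show ?thesis
        by (simp add: F)
    qed
    then show ?thesis
      using e(1) r\<^sub>0(1) by (intro stable[of "min e (r\<^sub>0 / 2)"]) auto
  qed
  ultimately show ?thesis
    by blast
qed

end
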